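(* Let $\Omega\subset\mathbb{R}^d$ be compact and $X:=C(\Omega)$. Let $\{A_j\}$ be a family of subspaces of $X$ defining the approximation spaces $A^{r,q}(X)$, with $n_j:=\dim A_j$ such that $\{n_j\}_{j\in\mathbb{N}}$ is a quasigeometric sequence, and let $\{\tilde\Pi_j\}_{j\in\mathbb{N}}$ be a family of uniformly bounded linear projection operators $\tilde\Pi_j:X\to A_j$ onto $A_j$. Suppose that $$\|f\|_{A^{1,\infty}(C(\Omega))}\lesssim\|f\|_{\mathrm{Lip}(1,C(\Omega))}.$$ Then $$d_{BL}(\tilde\Pi_{n_j}'\nu,\nu)\lesssim n_j^{-1}$$ for all $j\in\mathbb{N}$ and all probability measures $\nu\in\mathbb{M}^{+,1}(\Omega)$.
   Context: The approximant subspaces $\{A_n\}_{n\in\mathbb{N}_0}$ are finite dimensional linear subspaces of $X$ with $\{0\}=A_0\subseteq A_1\subseteq\dots\subseteq X$ and $\bigcup_nA_n$ dense in $X$. With $E_n(f,X):=\inf_{a\in A_n}\|f-a\|_X$, for $r>0$ and $1\le q\le\infty$ the space $A^{r,q}(X)$ consists of the $f\in X$ with $\|f\|_{A^{r,q}(X)}<\infty$, where $\|f\|_{A^{r,q}(X)}:=(\sum_{n\ge1}[n^rE_{n-1}(f,X)]^q\frac1n)^{1/q}$ for $q<\infty$ and $\|f\|_{A^{r,\infty}(X)}:=\sup_{n\ge1}n^rE_{n-1}(f,X)$. A sequence of positive integers $\{n_j\}$ is quasigeometric if there are constants $a,b$ with $1<a\le n_{j+1}/n_j\le b<\infty$ for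 all $j$. $X^*=C^*(\Omega)$ is identified with the regular signed (countably additive) measures on $\Omega$, and $\mathbb{M}^{+,1}(\Omega)\subset X^*$ is the set of probability measures. $\tilde\Pi_n':X^*\to X^*$ is the transpose: $\langle\tilde\Pi_n'\nu,f\rangle_{X^*\times X}=\langle\nu,\tilde\Pi_nf\rangle_{X^*\times X}$. The Lipschitz norm is $\|f\|_{\mathrm{Lip}(1,C(\Omega))}:=\|f\|_{C(\Omega)}+\sup_{x\ne y}|f(x)-f(y)|/\|x-y\|$, and for $\mu,\nu\in X^*$ $$d_{BL}(\mu,\nu):=\sup_{\|f\|_{\mathrm{Lip}(1,C(\Omega))}\le1}\left|\langle\mu-\nu,f\rangle_{X^*\times X}\right|.$$ $a\lesssim b$ means $a\le c\,b$ with a constant $c>0$ independent of $f$, $j$, $\nu$. *)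

theory Defs
  imports "HOL-Probability.Probability" "HOL-Library.Function_Algebras"
begin

text \<open>Pointwise real vector space structure on functions, so that the library's
  \<^const>\<open>subspace\<close>, \<^const>\<open>span\<close> and \<^const>\<open>dim\<close> apply to sets of real functions.\<close>

instantiation "fun" :: (type, real_vector) real_vector
begin

definition scaleR_fun :: "real \<Rightarrow> ('a \<Rightarrow> 'b) \<Rightarrow> 'a \<Rightarrow> 'b"
  where "scaleR_fun c f = (\<lambda>x. c *\<^sub>R f x)"

instance
  by standard (auto simp: scaleR_fun_def fun_eq_iff scaleR_add_left scaleR_add_right)

end

text \<open>A function on \<open>\<Omega>\<close> is represented by its extension by zero to the whole space, so that
  equality of representatives is equality on \<open>\<Omega>\<close>. All norms, distances and suprema take values
  in \<^typ>\<open>ennreal\<close>: an infinite supremum is \<open>\<infinity>\<close>, and an empty one is \<open>0\<close>.\<close>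

definition C_space :: "(real^'d) set \<Rightarrow> (real^'d \<Rightarrow> real) set"
  where "C_space \<Omega> = {f. continuous_on \<Omega> f \<and> (\<forall>x. x \<notin> \<Omega> \<longrightarrow> f x = 0)}"

definition C_norm :: "(real^'d) set \<Rightarrow> (real^'d \<Rightarrow> real) \<Rightarrow> ennreal"
  where "C_norm \<Omega> f = (SUP x\<in>\<Omega>. ennreal \<bar>f x\<bar>)"

definition Lip_norm :: "(real^'d) set \<Rightarrow> (real^'d \<Rightarrow> real) \<Rightarrow> ennreal"
  where "Lip_norm \<Omega> f = C_norm \<Omega> f +
    (SUP (x, y)\<in>{(x, y). x \<in> \<Omega> \<and> y \<in> \<Omega> \<and> x \<noteq> y}. ennreal (\<bar>f x - f y\<bar> / norm (x - y)))"

text \<open>Linearity on \<open>C(\<Omega>)\<close>, used both for operators and for functionals.\<close>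

definition linear_on_C :: "(real^'d) set \<Rightarrow> ((real^'d \<Rightarrow> real) \<Rightarrow> 'b::real_vector) \<Rightarrow> bool"
  where "linear_on_C \<Omega> T \<longleftrightarrow>
    (\<forall>f\<in>C_space \<Omega>. \<forall>g\<in>C_space \<Omega>. T (f + g) = T f + T g) \<and>
    (\<forall>c. \<forall>f\<in>C_space \<Omega>. T (c *\<^sub>R f) = c *\<^sub>R T f)"

definition approximant_family :: "(real^'d) set \<Rightarrow> (nat \<Rightarrow> (real^'d \<Rightarrow> real) set) \<Rightarrow> bool"
  where "approximant_family \<Omega> A \<longleftrightarrow>
    (\<forall>n. A n \<subseteq> C_space \<Omega> \<and> subspace (A n) \<and> (\<exists>B. finite B \<and> span B = A n)) \<and>
    A 0 = {0} \<and>
    (\<forall>n. A n \<subseteq> A (Suc n)) \<and>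
    (\<forall>f\<in>C_space \<Omega>. \<forall>e::real. e > 0 \<longrightarrow> (\<exists>a\<in>(\<Union>n. A n). C_norm \<Omega> (f - a) < ennreal e))"

definition approx_error ::
    "(real^'d) set \<Rightarrow> (nat \<Rightarrow> (real^'d \<Rightarrow> real) set) \<Rightarrow> nat \<Rightarrow> (real^'d \<Rightarrow> real) \<Rightarrow> ennreal"
  where "approx_error \<Omega> A n f = (INF a\<in>A n. C_norm \<Omega> (f - a))"

text \<open>The norm of \<open>A\<^sup>r\<^sup>,\<^sup>q(C(\<Omega>))\<close> for \<open>q = \<infinity>\<close>.\<close>

definition approx_norm_inf ::
    "(real^'d) set \<Rightarrow> (nat \<Rightarrow> (real^'d \<Rightarrow> real) set) \<Rightarrow> real \<Rightarrow> (real^'d \<Rightarrow> real) \<Rightarrow> ennreal"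
  where "approx_norm_inf \<Omega> A r f =
    (SUP n\<in>{1..}. ennreal (real n powr r) * approx_error \<Omega> A (n - 1) f)"

text \<open>Sequences here are indexed by the positive integers; the value at \<open>0\<close> is irrelevant.\<close>

definition quasigeometric :: "(nat \<Rightarrow> nat) \<Rightarrow> bool"
  where "quasigeometric s \<longleftrightarrow>
    (\<forall>j\<ge>1. s j > 0) \<and>
    (\<exists>a b::real. 1 < a \<and>
      (\<forall>j\<ge>1. a \<le> real (s (Suc j)) / real (s j) \<and> real (s (Suc j)) / real (s j) \<le> b))"

definition projection_onto ::
    "(real^'d) set \<Rightarrow> (real^'d \<Rightarrow> real) set \<Rightarrow> ((real^'d \<Rightarrow> real) \<Rightarrow> (real^'d \<Rightarrow> real)) \<Rightarrow> bool"
  where "projection_onto \<Omega> V P \<longleftrightarrow>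
    linear_on_C \<Omega> P \<and> P ` C_space \<Omega> = V \<and> (\<forall>f\<in>C_space \<Omega>. P (P f) = P f)"

text \<open>Elements of \<open>C*(\<Omega>)\<close> are bounded linear functionals; a measure is identified with the
  functional given by integration against it. On a compact subset of Euclidean space every
  finite Borel measure is regular, so probability measures carry no separate regularity condition.\<close>

definition C_dual :: "(real^'d) set \<Rightarrow> ((real^'d \<Rightarrow> real) \<Rightarrow> real) set"
  where "C_dual \<Omega> = {\<phi>. linear_on_C \<Omega> \<phi> \<and>
    (\<exists>B::real. \<forall>f\<in>C_space \<Omega>. ennreal \<bar>\<phi> f\<bar> \<le> ennreal B * C_norm \<Omega> f)}"

definition prob_measures :: "(real^'d) set \<Rightarrow> (real^'d) measure set"
  where "prob_measures \<Omega> = {\<nu>. prob_space \<nu> \<and> sets \<nu> = sets (restrict_space borel \<Omega>)}"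

definition measure_functional :: "(real^'d) measure \<Rightarrow> (real^'d \<Rightarrow> real) \<Rightarrow> real"
  where "measure_functional \<nu> f = (\<integral>x. f x \<partial>\<nu>)"

definition transpose_op ::
    "((real^'d \<Rightarrow> real) \<Rightarrow> (real^'d \<Rightarrow> real)) \<Rightarrow> ((real^'d \<Rightarrow> real) \<Rightarrow> real) \<Rightarrow> ((real^'d \<Rightarrow> real) \<Rightarrow> real)"
  where "transpose_op P \<phi> = (\<lambda>f. \<phi> (P f))"

definition d_BL ::
    "(real^'d) set \<Rightarrow> ((real^'d \<Rightarrow> real) \<Rightarrow> real) \<Rightarrow> ((real^'d \<Rightarrow> real) \<Rightarrow> real) \<Rightarrow> ennreal"
  where "d_BL \<Omega> \<phi> \<psi> = (SUP f\<in>{f \<in> C_space \<Omega>. Lip_norm \<Omega> f \<le> 1}. ennreal \<bar>\<phi> f - \<psi> f\<bar>)"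

lemma transpose_op_in_C_dual:
  assumes "\<phi> \<in> C_dual \<Omega>" "linear_on_C \<Omega> P" "P ` C_space \<Omega> \<subseteq> C_space \<Omega>"
    and "\<And>f. f \<in> C_space \<Omega> \<Longrightarrow> C_norm \<Omega> (P f) \<le> ennreal B * C_norm \<Omega> f"
  shows "transpose_op P \<phi> \<in> C_dual \<Omega>"
proof -
  from assms(1) obtain K where lin: "linear_on_C \<Omega> \<phi>"
    and K: "\<And>f. f \<in> C_space \<Omega> \<Longrightarrow> ennreal \<bar>\<phi> f\<bar> \<le> ennreal K * C_norm \<Omega> f"
    by (auto simp: C_dual_def)
  have "linear_on_C \<Omega> (transpose_op P \<phi>)"
    using lin assms(2,3) unfolding linear_on_C_def transpose_op_def by (simp add: image_subset_iff)
  moreover have "ennreal \<bar>transpose_op P \<phi> f\<bar> \<le> ennreal (max K 0 * max B 0) * C_norm \<Omega> f"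
    if "f \<in> C_space \<Omega>" for f
  proof -
    have "ennreal \<bar>\<phi> (P f)\<bar> \<le> ennreal K * C_norm \<Omega> (P f)"
      using K that assms(3) by blast
    also have "\<dots> \<le> ennreal K * (ennreal B * C_norm \<Omega> f)"
      using assms(4) that by (intro mult_left_mono) auto
    also have "\<dots> = ennreal (max K 0 * max B 0) * C_norm \<Omega> f"
    proof -
      have "ennreal K = ennreal (max K 0)" "ennreal B = ennreal (max B 0)"
        by (simp_all add: max_def ennreal_neg)
      then show ?thesis by (simp only: ennreal_mult max.cobounded2 mult.assoc)
    qed
    finally show ?thesis by (simp add: transpose_op_def)
  qed
  ultimately show ?thesis unfolding C_dual_def by blast
qed

lemma measure_functional_in_C_dual:
  fixes \<Omega> :: "(real^'d) set"
  assumes "compact \<Omega>" "\<nu> \<in> prob_measures \<Omega>"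
  shows "measure_functional \<nu> \<in> C_dual \<Omega>"
proof -
  interpret prob_space \<nu> using assms(2) by (simp add: prob_measures_def)
  have sets: "sets \<nu> = sets (restrict_space borel \<Omega>)" using assms(2) by (simp add: prob_measures_def)
  have sp: "space \<nu> = \<Omega>" using sets_eq_imp_space_eq[OF sets] by (simp add: space_restrict_space)
  have bdd: "\<exists>M\<ge>0. \<forall>x\<in>\<Omega>. \<bar>f x\<bar> \<le> M" if "f \<in> C_space \<Omega>" for f :: "real^'d \<Rightarrow> real"
  proof -
    have "bounded (f ` \<Omega>)"
      using that assms(1) by (intro compact_imp_bounded compact_continuous_image) (auto simp: C_space_def)
    then show ?thesis unfolding bounded_pos by (auto intro: less_imp_le)
  qed
  have int: "integrable \<nu> f" if f: "f \<in> C_space \<Omega>" for f :: "real^'d \<Rightarrow> real"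
  proof -
    obtain M where "\<forall>x\<in>\<Omega>. \<bar>f x\<bar> \<le> M" using bdd[OF f] by blast
    moreover have "f \<in> borel_measurable \<nu>"
      using borel_measurable_continuous_on_restrict[of \<Omega> f] f measurable_cong_sets[OF sets refl]
      by (auto simp: C_space_def)
    ultimately show ?thesis
      by (intro integrable_const_bound[of _ M] AE_I2) (simp_all add: sp)
  qed
  have "linear_on_C \<Omega> (measure_functional \<nu>)"
    unfolding linear_on_C_def measure_functional_def by (simp add: int scaleR_fun_def plus_fun_def)
  moreover have "ennreal \<bar>measure_functional \<nu> f\<bar> \<le> ennreal 1 * C_norm \<Omega> f"
    if f: "f \<in> C_space \<Omega>" for f
  proof -
    have "ennreal \<bar>measure_functional \<nu> f\<bar> \<le> (\<integral>\<^sup>+x. ennreal \<bar>f x\<bar> \<partial>\<nu>)"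
      using integral_norm_bound_ennreal[OF int[OF f]] by (simp add: measure_functional_def)
    also have "\<dots> \<le> (\<integral>\<^sup>+x. C_norm \<Omega> f \<partial>\<nu>)"
      by (intro nn_integral_mono) (auto simp: sp C_norm_def intro: SUP_upper)
    finally show ?thesis by (simp add: emeasure_space_1)
  qed
  ultimately show ?thesis unfolding C_dual_def by blast
qed

end

theory Submission
  imports Defs
begin

text \<open>A probability measure \<open>\<nu>\<close> has norm at most one as a functional on \<open>C(\<Omega>)\<close>, so
  \<open>\<langle>\<Pi>'\<nu> - \<nu>, f\<rangle> = \<langle>\<nu>, \<Pi> f - f\<rangle>\<close> is bounded by the uniform norm of the projection error
  \<open>\<Pi> f - f\<close>, whatever \<open>\<nu>\<close> is. By Lebesgue's lemma (\<open>projection_error_le_approx_error\<close>)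
  a projection of norm at most \<open>B\<close> onto \<open>A\<^sub>m\<close> is best possible up to the factor \<open>B + 1\<close>, so the
  error is at most \<open>(B + 1) E\<^sub>m(f)\<close>. The assumed embedding of the Lipschitz functions into
  \<open>A\<^sup>1\<^sup>,\<^sup>\<infinity>\<close> is the Jackson estimate \<open>E\<^sub>m(f) \<le> c / m\<close> on the Lipschitz unit ball
  (\<open>approx_error_le_of_approx_norm\<close>). The claim is the case \<open>m = n\<^sub>j\<close>; all constants are
  independent of \<open>f\<close>, \<open>j\<close> and \<open>\<nu>\<close>.\<close>

lemma C_space_diff:
  assumes "f \<in> C_space \<Omega>" "g \<in> C_space \<Omega>"
  shows "f - g \<in> C_space \<Omega>"
  using assms by (auto simp: C_space_def fun_diff_def intro!: continuous_on_diff)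

lemma linear_on_C_diff:
  assumes T: "linear_on_C \<Omega> T" and f: "f \<in> C_space \<Omega>" and g: "g \<in> C_space \<Omega>"
  shows "T (f - g) = T f - T g"
proof -
  have "T ((f - g) + g) = T (f - g) + T g"
    using T C_space_diff[OF f g] g unfolding linear_on_C_def by blast
  then show ?thesis by simp
qed

lemma C_norm_diff_le: "C_norm \<Omega> (f - g) \<le> C_norm \<Omega> f + C_norm \<Omega> g"
  unfolding C_norm_def
proof (rule SUP_least)
  fix x assume x: "x \<in> \<Omega>"
  have "ennreal \<bar>(f - g) x\<bar> \<le> ennreal (\<bar>f x\<bar> + \<bar>g x\<bar>)"
    by (intro ennreal_leI) simp
  also have "\<dots> = ennreal \<bar>f x\<bar> + ennreal \<bar>g x\<bar>" by simp
  also have "\<dots> \<le> (SUP x\<in>\<Omega>. ennreal \<bar>f x\<bar>) + (SUP x\<in>\<Omega>. ennreal \<bar>g x\<bar>)"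
    by (intro add_mono SUP_upper x)
  finally show "ennreal \<bar>(f - g) x\<bar> \<le> \<dots>" .
qed

lemma ennreal_inverse_mult_cancel:
  assumes "r > 0"
  shows "ennreal (inverse r) * (ennreal r * x) = x"
  using assms by (simp add: mult.assoc[symmetric] ennreal_mult[symmetric])

lemma measure_functional_le_C_norm:
  assumes "\<nu> \<in> prob_measures \<Omega>"
  shows "ennreal \<bar>measure_functional \<nu> f\<bar> \<le> C_norm \<Omega> f"
proof (cases "integrable \<nu> f")
  case True
  interpret prob_space \<nu> using assms by (simp add: prob_measures_def)
  have sp: "space \<nu> = \<Omega>"
    using assms sets_eq_imp_space_eq[of \<nu> "restrict_space borel \<Omega>"]
    by (simp add: prob_measures_def space_restrict_space)
  have "ennreal \<bar>measure_functional \<nu> f\<bar> \<le> (\<integral>\<^sup>+x. ennreal \<bar>f x\<bar> \<partial>\<nu>)"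
    using integral_norm_bound_ennreal[OF True] by (simp add: measure_functional_def)
  also have "\<dots> \<le> (\<integral>\<^sup>+x. C_norm \<Omega> f \<partial>\<nu>)"
    by (intro nn_integral_mono) (auto simp: sp C_norm_def intro: SUP_upper)
  finally show ?thesis by (simp add: emeasure_space_1)
next
  \<comment> \<open>the Bochner integral of a non-integrable function is zero by convention\<close>
  case False
  then show ?thesis by (simp add: measure_functional_def not_integrable_integral_eq)
qed

text \<open>Lebesgue's lemma: \<open>P\<close> fixes every \<open>a\<close> in its range, hence
  \<open>P f - f = P (f - a) - (f - a)\<close>, and \<open>a\<close> is arbitrary.\<close>

lemma projection_error_le_approx_error:
  assumes P: "projection_onto \<Omega> (A m) P" and A: "A m \<subseteq> C_space \<Omega>"
    and B: "\<And>g. g \<in> C_space \<Omega> \<Longrightarrow> C_norm \<Omega> (P g) \<le> ennreal b * C_norm \<Omega> g"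
    and b: "b \<ge> 0"
    and f: "f \<in> C_space \<Omega>"
  shows "C_norm \<Omega> (P f - f) \<le> ennreal (b + 1) * approx_error \<Omega> A m f"
proof -
  have lin: "linear_on_C \<Omega> P" and range: "P ` C_space \<Omega> = A m"
    and idem: "\<And>g. g \<in> C_space \<Omega> \<Longrightarrow> P (P g) = P g"
    using P by (auto simp: projection_onto_def)
  have le: "C_norm \<Omega> (P f - f) \<le> ennreal (b + 1) * C_norm \<Omega> (f - a)" if a: "a \<in> A m" for a
  proof -
    have aC: "a \<in> C_space \<Omega>" using a A by blast
    have "P a = a" using a range idem by force
    then have "P f - f = P (f - a) - (f - a)"
      using linear_on_C_diff[OF lin f aC] by simp
    then have "C_norm \<Omega> (P f - f) \<le> C_norm \<Omega> (P (f - a)) + C_norm \<Omega> (f - a)"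
      using C_norm_diff_le by metis
    also have "\<dots> \<le> ennreal b * C_norm \<Omega> (f - a) + C_norm \<Omega> (f - a)"
      by (intro add_right_mono B C_space_diff f aC)
    finally show ?thesis using b by (simp add: distrib_right)
  qed
  \<comment> \<open>the factor has to be moved to the left before passing to the infimum\<close>
  have "ennreal (inverse (b + 1)) * C_norm \<Omega> (P f - f) \<le> approx_error \<Omega> A m f"
    unfolding approx_error_def
  proof (rule INF_greatest)
    fix a assume a: "a \<in> A m"
    have "ennreal (inverse (b + 1)) * C_norm \<Omega> (P f - f)
        \<le> ennreal (inverse (b + 1)) * (ennreal (b + 1) * C_norm \<Omega> (f - a))"
      by (intro mult_left_mono le a) simp
    also have "\<dots> = C_norm \<Omega> (f - a)"
      using b by (intro ennreal_inverse_mult_cancel) simp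
    finally show "ennreal (inverse (b + 1)) * C_norm \<Omega> (P f - f) \<le> C_norm \<Omega> (f - a)" .
  qed
  then have "ennreal (b + 1) * (ennreal (inverse (b + 1)) * C_norm \<Omega> (P f - f))
      \<le> ennreal (b + 1) * approx_error \<Omega> A m f"
    by (rule mult_left_mono) simp
  then show ?thesis
    using b ennreal_inverse_mult_cancel[of "inverse (b + 1)"] by simp
qed

lemma approx_error_le_of_approx_norm:
  assumes "approx_norm_inf \<Omega> A 1 f \<le> ennreal c" and "m > 0"
  shows "approx_error \<Omega> A m f \<le> ennreal (c * inverse (real m))"
proof -
  \<comment> \<open>\<open>E\<^sub>m\<close> is the term of index \<open>m + 1\<close> in the norm, so its weight is \<open>m + 1 \<ge> m\<close>\<close>
  have "ennreal (real m) * approx_error \<Omega> A m f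
      \<le> ennreal (real (Suc m) powr 1) * approx_error \<Omega> A (Suc m - 1) f"
    by (auto intro!: mult_right_mono ennreal_leI)
  also have "\<dots> \<le> approx_norm_inf \<Omega> A 1 f"
    unfolding approx_norm_inf_def by (rule SUP_upper) simp
  also have "\<dots> \<le> ennreal c" by (rule assms(1))
  finally have *: "ennreal (real m) * approx_error \<Omega> A m f \<le> ennreal c" .
  have "approx_error \<Omega> A m f
      = ennreal (inverse (real m)) * (ennreal (real m) * approx_error \<Omega> A m f)"
    using assms(2) by (simp add: ennreal_inverse_mult_cancel)
  also have "\<dots> \<le> ennreal (inverse (real m)) * ennreal c"
    by (intro mult_left_mono *) simp
  also have "\<dots> = ennreal (c * inverse (real m))"
    by (subst ennreal_mult'[symmetric]) (simp_all add: mult.commute)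
  finally show ?thesis .
qed

theorem corollary7p3:
  fixes \<Omega> :: "(real^'d) set"
    and A :: "nat \<Rightarrow> (real^'d \<Rightarrow> real) set"
    and P :: "nat \<Rightarrow> (real^'d \<Rightarrow> real) \<Rightarrow> (real^'d \<Rightarrow> real)"
    and n :: "nat \<Rightarrow> nat"
  assumes "compact \<Omega>"
    and "approximant_family \<Omega> A"
    and "\<And>j. n j = dim (A j)"
    and "quasigeometric n"
    and "\<And>j. j \<ge> 1 \<Longrightarrow> projection_onto \<Omega> (A j) (P j)"
    and "\<exists>B::real. \<forall>j\<ge>1. \<forall>f\<in>C_space \<Omega>. C_norm \<Omega> (P j f) \<le> ennreal B * C_norm \<Omega> f"
    and "\<exists>c>0. \<forall>f\<in>C_space \<Omega>. approx_norm_inf \<Omega> A 1 f \<le> ennreal c * Lip_norm \<Omega> f"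
  shows "\<exists>c>0. \<forall>j\<ge>1. \<forall>\<nu>\<in>prob_measures \<Omega>.
    d_BL \<Omega> (transpose_op (P (n j)) (measure_functional \<nu>)) (measure_functional \<nu>)
      \<le> ennreal (c * inverse (real (n j)))"
proof -
  from assms(6) obtain B where
    B: "\<And>j f. j \<ge> 1 \<Longrightarrow> f \<in> C_space \<Omega> \<Longrightarrow> C_norm \<Omega> (P j f) \<le> ennreal B * C_norm \<Omega> f"
    by blast
  \<comment> \<open>\<open>ennreal\<close> truncates negative reals to zero\<close>
  define b where "b = max B 0"
  have "ennreal B = ennreal b" by (simp add: b_def max_def ennreal_neg)
  with B have B': "\<And>j f. j \<ge> 1 \<Longrightarrow> f \<in> C_space \<Omega> \<Longrightarrow>
      C_norm \<Omega> (P j f) \<le> ennreal b * C_norm \<Omega> f"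
    by simp
  have b: "b \<ge> 0" by (simp add: b_def)
  from assms(7) obtain c where c: "c > 0" and
    jackson: "\<And>f. f \<in> C_space \<Omega> \<Longrightarrow> approx_norm_inf \<Omega> A 1 f \<le> ennreal c * Lip_norm \<Omega> f"
    by blast
  have A: "A m \<subseteq> C_space \<Omega>" for m
    using assms(2) by (auto simp: approximant_family_def)
  show ?thesis
  proof (intro exI[of _ "(b + 1) * c"] conjI allI impI ballI)
    show "(b + 1) * c > 0" using b c by simp
  next
    fix j \<nu> assume j: "j \<ge> (1::nat)" and \<nu>: "\<nu> \<in> prob_measures \<Omega>"
    have m: "n j \<ge> 1"
      using assms(4) j by (auto simp: quasigeometric_def Suc_le_eq)
    show "d_BL \<Omega> (transpose_op (P (n j)) (measure_functional \<nu>)) (measure_functional \<nu>)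
      \<le> ennreal ((b + 1) * c * inverse (real (n j)))"
      unfolding d_BL_def
    proof (rule SUP_least)
      fix f assume "f \<in> {f \<in> C_space \<Omega>. Lip_norm \<Omega> f \<le> 1}"
      then have f: "f \<in> C_space \<Omega>" and lip: "Lip_norm \<Omega> f \<le> 1" by auto
      have Pf: "P (n j) f \<in> C_space \<Omega>"
        using assms(5)[OF m] A f by (auto simp: projection_onto_def)
      have "linear_on_C \<Omega> (measure_functional \<nu>)"
        using measure_functional_in_C_dual[OF assms(1) \<nu>] by (simp add: C_dual_def)
      then have "ennreal \<bar>transpose_op (P (n j)) (measure_functional \<nu>) f - measure_functional \<nu> f\<bar>
          = ennreal \<bar>measure_functional \<nu> (P (n j) f - f)\<bar>"
        using Pf f by (simp add: transpose_op_def linear_on_C_diff)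
      also have "\<dots> \<le> C_norm \<Omega> (P (n j) f - f)"
        by (rule measure_functional_le_C_norm[OF \<nu>])
      also have "\<dots> \<le> ennreal (b + 1) * approx_error \<Omega> A (n j) f"
        by (rule projection_error_le_approx_error[where A = A, OF assms(5)[OF m] A B'[OF m] b f])
      also have "\<dots> \<le> ennreal (b + 1) * ennreal (c * inverse (real (n j)))"
      proof (intro mult_left_mono approx_error_le_of_approx_norm)
        have "approx_norm_inf \<Omega> A 1 f \<le> ennreal c * Lip_norm \<Omega> f" by (rule jackson[OF f])
        also have "\<dots> \<le> ennreal c * 1" by (intro mult_left_mono lip) simp
        finally show "approx_norm_inf \<Omega> A 1 f \<le> ennreal c" by simp
      qed (use m in simp_all)
      also have "\<dots> = ennreal ((b + 1) * c * inverse (real (n j)))"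
        using b by (simp only: mult.assoc ennreal_mult'[of "b + 1"])
      finally show "ennreal \<bar>transpose_op (P (n j)) (measure_functional \<nu>) f - measure_functional \<nu> f\<bar>
          \<le> \<dots>" .
    qed
  qed
qed

end
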